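(* In the symmetric linear generalized flow problem described in the context, for a pseudoflow $f$ the following are equivalent: (i) $f$ is an optimal solution (i.e., minimizes the excess discrepancy); (ii) the residual network $E_f$ contains no generalized augmenting path; (iii) there exists a conservative labeling $\mu$ such that $e_i=0$ for every $i\in V$ with $1/M_i<\mu_i<\infty$.
   Context: Let $G=(V,E)$ be a directed graph with upper capacities $u:E\to\mathbb{R}_{\ge0}$, lower capacities $0$, gain factors $\gamma:E\to\mathbb{R}_{>0}$ and node demands $b:V\to\mathbb{R}$. A pseudoflow is $f:E\to\mathbb{R}$ with $0\le f\le u$, with excesses $e_i=\sum_{j:ji\in E}\gamma_{ji}f_{ji}-\sum_{j:ij\in E}f_{ij}-b_i$. Penalty factors $M_i\in(0,\infty]$ are given; the problem is to minimize $\sum_i M_i\kappa_i$ over pseudoflows and $\kappa\ge0$ with $e_i+\kappa_i\ge0$ for all $i$ (with the convention $\infty\cdot0=0$, $1/\infty=0$). Residual network $E_f$: $ij\in E_f$ if $ij\in E$ and $f_{ij}<u_{ij}$ (forward arc, gain $\gamma_{ij}$), or if $ji\in E$ and $f_{ji}>0$ (backward arc, gain $\gamma_{ij}:=1/\gamma_{ji}$). For a path or cycle $P$ let $\gamma(P)=\prod_{e\in P}\gamma_e$; a cycle $C$ is flow generating if $\gamma(C)>1$. A generalized augmenting path (GAP) is a pair $(C,P)$ with either (a) $C$ a flow generating cycle in $E_f$, $i_0\in V(C)$, $t$ a node with $e_t<0$ and $P$ a path in $E_f$ from $i_0$ to $t$ (possibly $i_0=t$, $P=\emptyset$); or (b)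 $C=\emptyset$ and $P$ a path in $E_f$ from $s$ to $t$ with $e_s>0$, $e_t<0$; or (c) $C=\emptyset$ and $P$ a path in $E_f$ from $s$ to $t$ with $e_s\le0$, $e_t<0$ and $\gamma(P)>M_s/M_t$. A labeling is $\mu:V\to\mathbb{R}_{>0}\cup\{\infty\}$; relabeled gains are $\gamma^\mu_{ij}=\gamma_{ij}\mu_i/\mu_j$, with conventions: if $\mu_i=\infty$ then $\gamma^\mu_{ji}=0$ for $ji\in E_f$, and if $\mu_i=\infty,\mu_j<\infty$ then $\gamma^\mu_{ij}=\infty$ for $ij\in E_f$. $\mu$ is conservative if $\gamma^\mu_{ij}\le1$ for all $ij\in E_f$, $\mu_i\ge1/M_i$ for all $i$, and $\mu_i=1/M_i$ whenever $e_i<0$.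
   Formalization: Condition (iii) additionally requires e_i ≤ 0 whenever μ_i = 1/M_i (as printed, (iii) does not imply (i) or (ii)); and an optimal solution must have finite excess discrepancy, since otherwise (i) holds for every f while (ii) and (iii) fail. *)

theory Defs
  imports "Graph_Theory.Graph_Theory" "HOL-Library.Extended_Real"
begin

definition excess ::
  "'v pair_pre_digraph \<Rightarrow> ('v \<times> 'v \<Rightarrow> real) \<Rightarrow> ('v \<Rightarrow> real) \<Rightarrow> ('v \<times> 'v \<Rightarrow> real) \<Rightarrow> 'v \<Rightarrow> real"
where
  "excess G \<gamma> b f i =
     (\<Sum>j\<in>{j. (j, i) \<in> parcs G}. \<gamma> (j, i) * f (j, i))
     - (\<Sum>j\<in>{j. (i, j) \<in> parcs G}. f (i, j)) - b i"

definition pseudoflow ::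
  "'v pair_pre_digraph \<Rightarrow> ('v \<times> 'v \<Rightarrow> real) \<Rightarrow> ('v \<times> 'v \<Rightarrow> real) \<Rightarrow> bool"
where
  "pseudoflow G u f \<longleftrightarrow> (\<forall>a\<in>parcs G. 0 \<le> f a \<and> f a \<le> u a)"

text \<open>
  Penalties and labels live in \<^typ>\<open>ereal\<close>, whose arithmetic satisfies
  \<open>\<infinity> * 0 = 0\<close>, \<open>1 / \<infinity> = 0\<close> and \<open>x / y = x * (1 / y)\<close>; in particular \<open>\<infinity> / \<infinity> = 0\<close>.
\<close>

definition feasible ::
  "'v pair_pre_digraph \<Rightarrow> ('v \<times> 'v \<Rightarrow> real) \<Rightarrow> ('v \<times> 'v \<Rightarrow> real) \<Rightarrow> ('v \<Rightarrow> real) \<Rightarrow>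
    ('v \<times> 'v \<Rightarrow> real) \<Rightarrow> ('v \<Rightarrow> real) \<Rightarrow> bool"
where
  "feasible G u \<gamma> b f \<kappa> \<longleftrightarrow>
     pseudoflow G u f \<and> (\<forall>i\<in>pverts G. 0 \<le> \<kappa> i \<and> 0 \<le> excess G \<gamma> b f i + \<kappa> i)"

definition discrepancy :: "'v pair_pre_digraph \<Rightarrow> ('v \<Rightarrow> ereal) \<Rightarrow> ('v \<Rightarrow> real) \<Rightarrow> ereal" where
  "discrepancy G M \<kappa> = (\<Sum>i\<in>pverts G. M i * ereal (\<kappa> i))"

text \<open>
  An infinite penalty is a hard constraint, so a solution of infinite value counts as infeasible
  and is never optimal. Once some solution has finite value, optimality is plain minimality
  (lemma \<open>optimal_iff_minimizer\<close>).
\<close>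

definition optimal ::
  "'v pair_pre_digraph \<Rightarrow> ('v \<times> 'v \<Rightarrow> real) \<Rightarrow> ('v \<times> 'v \<Rightarrow> real) \<Rightarrow> ('v \<Rightarrow> real) \<Rightarrow>
    ('v \<Rightarrow> ereal) \<Rightarrow> ('v \<times> 'v \<Rightarrow> real) \<Rightarrow> bool"
where
  "optimal G u \<gamma> b M f \<longleftrightarrow>
     (\<exists>\<kappa>. feasible G u \<gamma> b f \<kappa> \<and> discrepancy G M \<kappa> < \<infinity> \<and>
       (\<forall>f' \<kappa>'. feasible G u \<gamma> b f' \<kappa>' \<longrightarrow> discrepancy G M \<kappa> \<le> discrepancy G M \<kappa>'))"

lemma optimal_iff_minimizer:
  assumes "feasible G u \<gamma> b f0 \<kappa>0" "discrepancy G M \<kappa>0 < \<infinity>"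
  shows "optimal G u \<gamma> b M f \<longleftrightarrow>
     (\<exists>\<kappa>. feasible G u \<gamma> b f \<kappa> \<and>
       (\<forall>f' \<kappa>'. feasible G u \<gamma> b f' \<kappa>' \<longrightarrow> discrepancy G M \<kappa> \<le> discrepancy G M \<kappa>'))"
  unfolding optimal_def using assms by (meson order_le_less_trans)

text \<open>
  A residual arc remembers the arc it comes from, so that the forward copy of \<open>ij\<close> and the
  backward copy of \<open>ji\<close> stay distinct, with their own gains, when both arcs are in the graph.
\<close>

datatype 'v residual_arc = Forward "'v \<times> 'v" | Backward "'v \<times> 'v"

fun res_tail :: "'v residual_arc \<Rightarrow> 'v" where
  "res_tail (Forward a) = fst a"
| "res_tail (Backward a) = snd a"

fun res_head :: "'v residual_arc \<Rightarrow> 'v" where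
  "res_head (Forward a) = snd a"
| "res_head (Backward a) = fst a"

fun res_gain :: "('v \<times> 'v \<Rightarrow> real) \<Rightarrow> 'v residual_arc \<Rightarrow> real" where
  "res_gain \<gamma> (Forward a) = \<gamma> a"
| "res_gain \<gamma> (Backward a) = 1 / \<gamma> a"

definition residual ::
  "'v pair_pre_digraph \<Rightarrow> ('v \<times> 'v \<Rightarrow> real) \<Rightarrow> ('v \<times> 'v \<Rightarrow> real) \<Rightarrow> ('v, 'v residual_arc) pre_digraph"
where
  "residual G u f =
     \<lparr> verts = pverts G,
       arcs = {Forward a |a. a \<in> parcs G \<and> f a < u a} \<union> {Backward a |a. a \<in> parcs G \<and> 0 < f a},
       tail = res_tail, head = res_head \<rparr>"

definition walk_gain :: "('v \<times> 'v \<Rightarrow> real) \<Rightarrow> 'v residual_arc list \<Rightarrow> real" where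
  "walk_gain \<gamma> p = prod_list (map (res_gain \<gamma>) p)"

text \<open>
  The empty walk is a path from every node to itself, and \<open>C = []\<close> encodes \<open>C = \<emptyset>\<close>
  (a \<^const>\<open>pre_digraph.cycle\<close> is nonempty). The node set of a cycle is the set of tails of
  its arcs.
\<close>

definition gap ::
  "'v pair_pre_digraph \<Rightarrow> ('v \<times> 'v \<Rightarrow> real) \<Rightarrow> ('v \<times> 'v \<Rightarrow> real) \<Rightarrow> ('v \<Rightarrow> real) \<Rightarrow>
    ('v \<Rightarrow> ereal) \<Rightarrow> ('v \<times> 'v \<Rightarrow> real) \<Rightarrow> 'v residual_arc list \<Rightarrow> 'v residual_arc list \<Rightarrow> bool"
where
  "gap G u \<gamma> b M f C P \<longleftrightarrow>
     (\<exists>i\<^sub>0 t. pre_digraph.cycle (residual G u f) C \<and> 1 < walk_gain \<gamma> C \<and> i\<^sub>0 \<in> res_tail ` set C \<and>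
        pre_digraph.apath (residual G u f) i\<^sub>0 P t \<and> excess G \<gamma> b f t < 0)
   \<or> (C = [] \<and> (\<exists>s t. pre_digraph.apath (residual G u f) s P t \<and>
        0 < excess G \<gamma> b f s \<and> excess G \<gamma> b f t < 0))
   \<or> (C = [] \<and> (\<exists>s t. pre_digraph.apath (residual G u f) s P t \<and>
        excess G \<gamma> b f s \<le> 0 \<and> excess G \<gamma> b f t < 0 \<and> M s / M t < ereal (walk_gain \<gamma> P)))"

text \<open>
  For positive labels, \<^typ>\<open>ereal\<close> arithmetic makes the relabeled gain \<open>0\<close> if the head is
  labeled \<open>\<infinity>\<close>, and \<open>\<infinity>\<close> if only the tail is.
\<close>

definition relabeled_gain ::
  "('v \<times> 'v \<Rightarrow> real) \<Rightarrow> ('v \<Rightarrow> ereal) \<Rightarrow> 'v residual_arc \<Rightarrow> ereal"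
where
  "relabeled_gain \<gamma> \<mu> a = ereal (res_gain \<gamma> a) * \<mu> (res_tail a) / \<mu> (res_head a)"

definition labeling :: "'v pair_pre_digraph \<Rightarrow> ('v \<Rightarrow> ereal) \<Rightarrow> bool" where
  "labeling G \<mu> \<longleftrightarrow> (\<forall>i\<in>pverts G. 0 < \<mu> i)"

definition conservative ::
  "'v pair_pre_digraph \<Rightarrow> ('v \<times> 'v \<Rightarrow> real) \<Rightarrow> ('v \<times> 'v \<Rightarrow> real) \<Rightarrow> ('v \<Rightarrow> real) \<Rightarrow>
    ('v \<Rightarrow> ereal) \<Rightarrow> ('v \<times> 'v \<Rightarrow> real) \<Rightarrow> ('v \<Rightarrow> ereal) \<Rightarrow> bool"
where
  "conservative G u \<gamma> b M f \<mu> \<longleftrightarrow>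
     labeling G \<mu> \<and>
     (\<forall>a\<in>arcs (residual G u f). relabeled_gain \<gamma> \<mu> a \<le> 1) \<and>
     (\<forall>i\<in>pverts G. 1 / M i \<le> \<mu> i) \<and>
     (\<forall>i\<in>pverts G. excess G \<gamma> b f i < 0 \<longrightarrow> \<mu> i = 1 / M i)"

end

theory Submission
  imports Defs
begin

text \<open>
  The program is linear, with dual variables \<open>\<pi> = 1 / \<mu>\<close>. A generalized augmenting path yields
  a direction of the flow that respects the capacities and along which the penalty decreases, so an
  optimal pseudoflow admits none. If there is none, then every node \<open>i\<close> that reaches a deficit node
  \<open>t\<close> gets as \<open>\<pi> i\<close> the largest \<open>M t * walk_gain \<gamma> P\<close> over the paths \<open>P\<close> from \<open>i\<close> to deficit nodes,
  and the others get \<open>\<pi> i = 0\<close>; the lack of flow generating cycles that reach a deficit makes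
  these values conservative. Finally, the conditions on the labeling are those of complementary slackness.
\<close>

text \<open>A small positive step preserves finitely many inequalities: strict ones by continuity,
  tight ones because the direction does not decrease them.\<close>

lemma eventually_nonneg_affine:
  fixes c d :: "'i \<Rightarrow> real"
  assumes "finite I" "\<And>i. i \<in> I \<Longrightarrow> 0 \<le> c i" "\<And>i. i \<in> I \<Longrightarrow> c i = 0 \<Longrightarrow> 0 \<le> d i"
  shows "\<forall>\<^sub>F \<epsilon> in at_right 0. \<forall>i\<in>I. 0 \<le> c i + \<epsilon> * d i"
proof (rule eventually_ball_finite[OF assms(1)], rule)
  fix i assume i: "i \<in> I"
  show "\<forall>\<^sub>F \<epsilon> in at_right 0. 0 \<le> c i + \<epsilon> * d i"
  proof (cases "c i = 0")
    case True
    then show ?thesis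
      using assms(3)[OF i] by (intro eventually_at_rightI[of 0 1]) auto
  next
    case False
    have "((\<lambda>\<epsilon>. c i + \<epsilon> * d i) \<longlongrightarrow> c i + 0 * d i) (at_right 0)"
      by (intro tendsto_intros)
    then have "\<forall>\<^sub>F \<epsilon> in at_right 0. 0 < c i + \<epsilon> * d i"
      by (rule order_tendstoD) (use False assms(2)[OF i] in auto)
    then show ?thesis
      by eventually_elim simp
  qed
qed

lemma walk_gain_simps [simp]:
  "walk_gain \<gamma> [] = 1" "walk_gain \<gamma> (r # p) = res_gain \<gamma> r * walk_gain \<gamma> p"
  "walk_gain \<gamma> (p @ q) = walk_gain \<gamma> p * walk_gain \<gamma> q"
  by (simp_all add: walk_gain_def)

section \<open>The residual network as a finite digraph with positive gains\<close>

locale generalized_flow = pair_fin_digraph G for G :: "'v pair_pre_digraph" +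
  fixes u \<gamma> f :: "'v \<times> 'v \<Rightarrow> real" and b :: "'v \<Rightarrow> real" and M :: "'v \<Rightarrow> ereal"
  assumes gain_pos: "a \<in> parcs G \<Longrightarrow> 0 < \<gamma> a"
    and penalty_pos: "i \<in> pverts G \<Longrightarrow> 0 < M i"
    and pseudoflow: "pseudoflow G u f"
begin

lemma residual_simps [simp]:
  "verts (residual G u f) = pverts G" "tail (residual G u f) = res_tail"
  "head (residual G u f) = res_head"
  by (simp_all add: residual_def)

lemma arcs_residual:
  "r \<in> arcs (residual G u f) \<longleftrightarrow>
     (\<exists>a\<in>parcs G. r = Forward a \<and> f a < u a \<or> r = Backward a \<and> 0 < f a)"
  by (auto simp: residual_def)

sublocale res: fin_digraph "residual G u f"
proof
  show "finite (arcs (residual G u f))"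
  proof (rule finite_subset)
    show "arcs (residual G u f) \<subseteq> Forward ` parcs G \<union> Backward ` parcs G"
      by (auto simp: residual_def)
  qed (simp add: pair_finite_arcs)
qed (use pair_finite_verts in \<open>auto simp: arcs_residual wellformed'\<close>)

lemma res_gain_pos: "r \<in> arcs (residual G u f) \<Longrightarrow> 0 < res_gain \<gamma> r"
  using gain_pos by (auto simp: arcs_residual)

lemma walk_gain_pos: "set p \<subseteq> arcs (residual G u f) \<Longrightarrow> 0 < walk_gain \<gamma> p"
  by (induction p) (auto simp: res_gain_pos)

abbreviation e :: "'v \<Rightarrow> real" where "e \<equiv> excess G \<gamma> b f"

subsection \<open>Net inflow\<close>

text \<open>The linear part of the excess, as a single sum over the arcs, so that linearity and the
  exchange of summations are immediate.\<close>

definition net :: "('v \<times> 'v \<Rightarrow> real) \<Rightarrow> 'v \<Rightarrow> real" where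
  "net g i = (\<Sum>a\<in>parcs G. g a * (\<gamma> a * of_bool (snd a = i) - of_bool (fst a = i)))"

lemma excess_eq: "excess G \<gamma> b g i = net g i - b i"
proof -
  have "(\<Sum>j\<in>{j. (j, i) \<in> parcs G}. \<gamma> (j, i) * g (j, i)) = (\<Sum>a\<in>{a\<in>parcs G. snd a = i}. \<gamma> a * g a)"
    by (rule sum.reindex_bij_witness[of _ fst "\<lambda>j. (j, i)"]) auto
  moreover have "(\<Sum>j\<in>{j. (i, j) \<in> parcs G}. g (i, j)) = (\<Sum>a\<in>{a\<in>parcs G. fst a = i}. g a)"
    by (rule sum.reindex_bij_witness[of _ snd "\<lambda>j. (i, j)"]) auto
  moreover have "net g i = (\<Sum>a\<in>parcs G. if snd a = i then \<gamma> a * g a else 0) -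
      (\<Sum>a\<in>parcs G. if fst a = i then g a else 0)"
    unfolding net_def sum_subtractf[symmetric] by (rule sum.cong) (auto simp: algebra_simps)
  ultimately show ?thesis
    using pair_finite_arcs by (simp add: excess_def sum.inter_filter)
qed

lemma net_add: "net (\<lambda>a. g a + h a) i = net g i + net h i"
  by (simp add: net_def distrib_right sum.distrib)

lemma net_scale: "net (\<lambda>a. c * g a) i = c * net g i"
  by (simp add: net_def sum_distrib_left mult.assoc)

text \<open>Transposition of the generalized incidence matrix: node potentials \<open>\<pi>\<close>
  turn into reduced gains of the arcs. This is the link between the primal and the dual
  side.\<close>

lemma sum_mult_net:
  "(\<Sum>i\<in>pverts G. \<pi> i * net g i) = (\<Sum>a\<in>parcs G. g a * (\<gamma> a * \<pi> (snd a) - \<pi> (fst a)))"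
proof -
  have "(\<Sum>i\<in>pverts G. \<pi> i * net g i) =
      (\<Sum>a\<in>parcs G. \<Sum>i\<in>pverts G. \<pi> i * (g a * (\<gamma> a * of_bool (snd a = i) - of_bool (fst a = i))))"
    unfolding net_def sum_distrib_left by (rule sum.swap)
  also have "\<dots> = (\<Sum>a\<in>parcs G. g a * (\<gamma> a * \<pi> (snd a) - \<pi> (fst a)))"
  proof (rule sum.cong[OF refl])
    fix a assume "a \<in> parcs G"
    then have "snd a \<in> pverts G" "fst a \<in> pverts G"
      by (auto simp: arc_fst_in_verts arc_snd_in_verts)
    moreover have "(\<Sum>i\<in>pverts G. \<pi> i * (g a * (\<gamma> a * of_bool (snd a = i) - of_bool (fst a = i)))) =
        (\<Sum>i\<in>pverts G. if snd a = i then g a * (\<gamma> a * \<pi> i) else 0) -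
        (\<Sum>i\<in>pverts G. if fst a = i then g a * \<pi> i else 0)"
      unfolding sum_subtractf[symmetric] by (rule sum.cong) (auto simp: algebra_simps)
    ultimately show "(\<Sum>i\<in>pverts G. \<pi> i * (g a * (\<gamma> a * of_bool (snd a = i) - of_bool (fst a = i))))
        = g a * (\<gamma> a * \<pi> (snd a) - \<pi> (fst a))"
      using pair_finite_verts by (simp add: right_diff_distrib)
  qed
  finally show ?thesis .
qed

subsection \<open>Discrepancy\<close>

text \<open>Where the penalty is infinite both products vanish, as
  \<open>\<infinity> * 0 = 0\<close> and \<open>real_of_ereal \<infinity> = 0\<close>; hence the
  objective can be handled in real arithmetic.\<close>

lemma discrepancy_real:
  assumes "\<And>i. i \<in> pverts G \<Longrightarrow> M i = \<infinity> \<Longrightarrow> \<kappa> i = 0"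
  shows "discrepancy G M \<kappa> = ereal (\<Sum>i\<in>pverts G. real_of_ereal (M i) * \<kappa> i)"
proof -
  have "M i * ereal (\<kappa> i) = ereal (real_of_ereal (M i) * \<kappa> i)" if "i \<in> pverts G" for i
    using assms[OF that] penalty_pos[OF that] by (cases "M i") (auto simp: zero_ereal_def)
  then show ?thesis
    by (simp add: discrepancy_def)
qed

lemma discrepancy_finite:
  assumes "discrepancy G M \<kappa> < \<infinity>" "\<And>i. i \<in> pverts G \<Longrightarrow> 0 \<le> \<kappa> i" "i \<in> pverts G" "M i = \<infinity>"
  shows "\<kappa> i = 0"
proof (rule ccontr)
  assume "\<kappa> i \<noteq> 0"
  then have "M i * ereal (\<kappa> i) = \<infinity>"
    using assms by (simp add: order_less_le)
  then have "discrepancy G M \<kappa> = \<infinity>"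
    using assms(3) pair_finite_verts unfolding discrepancy_def sum_Pinfty by metis
  then show False
    using assms(1) by simp
qed

subsection \<open>Descent directions\<close>

text \<open>The directions in which a sufficiently small step from \<open>f\<close> respects the
  capacities; the two sign conditions match the presence of the forward and of the backward residual
  arc.\<close>

definition admissible :: "('v \<times> 'v \<Rightarrow> real) \<Rightarrow> bool" where
  "admissible g \<longleftrightarrow> (\<forall>a\<in>parcs G. (0 < g a \<longrightarrow> f a < u a) \<and> (g a < 0 \<longrightarrow> 0 < f a))"

lemma admissible_add:
  assumes "admissible g" "admissible h"
  shows "admissible (\<lambda>a. g a + h a)"
  unfolding admissible_def
proof (intro ballI conjI impI)
  fix a assume a: "a \<in> parcs G"
  show "f a < u a" if "0 < g a + h a"
  proof -
    from that have "0 < g a \<or> 0 < h a" by linarith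
    then show ?thesis using a assms by (auto simp: admissible_def)
  qed
  show "0 < f a" if "g a + h a < 0"
  proof -
    from that have "g a < 0 \<or> h a < 0" by linarith
    then show ?thesis using a assms by (auto simp: admissible_def)
  qed
qed

lemma admissible_scale: "admissible g \<Longrightarrow> 0 < c \<Longrightarrow> admissible (\<lambda>a. c * g a)"
  by (auto simp: admissible_def zero_less_mult_iff mult_less_0_iff)

text \<open>\<open>k0\<close> and \<open>ek\<close> constrain the direction only at tight
  inequalities, since slack ones survive a small step. \<open>kinf\<close> keeps the objective
  finite, so it changes linearly with slope \<open>neg\<close>.\<close>

lemma feasible_descent:
  assumes feas: "feasible G u \<gamma> b f \<kappa>" and fin: "discrepancy G M \<kappa> < \<infinity>"
    and g: "admissible g"
    and k0: "\<And>i. i \<in> pverts G \<Longrightarrow> \<kappa> i = 0 \<Longrightarrow> 0 \<le> k i"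
    and ek: "\<And>i. i \<in> pverts G \<Longrightarrow> e i + \<kappa> i = 0 \<Longrightarrow> 0 \<le> net g i + k i"
    and kinf: "\<And>i. i \<in> pverts G \<Longrightarrow> M i = \<infinity> \<Longrightarrow> k i = 0"
    and neg: "(\<Sum>i\<in>pverts G. real_of_ereal (M i) * k i) < 0"
  obtains f' \<kappa>' where "feasible G u \<gamma> b f' \<kappa>'" "discrepancy G M \<kappa>' < discrepancy G M \<kappa>"
proof -
  have lower: "\<forall>\<^sub>F \<epsilon> in at_right 0. \<forall>a\<in>parcs G. 0 \<le> f a + \<epsilon> * g a"
    using pseudoflow g pair_finite_arcs
    by (intro eventually_nonneg_affine) (force simp: pseudoflow_def admissible_def)+
  have upper: "\<forall>\<^sub>F \<epsilon> in at_right 0. \<forall>a\<in>parcs G. 0 \<le> (u a - f a) + \<epsilon> * (- g a)"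
    using pseudoflow g pair_finite_arcs
    by (intro eventually_nonneg_affine) (force simp: pseudoflow_def admissible_def)+
  have slack: "\<forall>\<^sub>F \<epsilon> in at_right 0. \<forall>i\<in>pverts G. 0 \<le> \<kappa> i + \<epsilon> * k i"
    using feas k0 pair_finite_verts by (intro eventually_nonneg_affine) (auto simp: feasible_def)
  have exc: "\<forall>\<^sub>F \<epsilon> in at_right 0. \<forall>i\<in>pverts G. 0 \<le> (e i + \<kappa> i) + \<epsilon> * (net g i + k i)"
    using feas ek pair_finite_verts by (intro eventually_nonneg_affine) (auto simp: feasible_def)
  have pos: "\<forall>\<^sub>F \<epsilon> in at_right (0::real). 0 < \<epsilon>"
    by (rule eventually_at_right_less)
  from eventually_happens'[OF _ eventually_conj[OF pos eventually_conj[OF lower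
        eventually_conj[OF upper eventually_conj[OF slack exc]]]]]
  obtain \<epsilon> where \<epsilon>: "0 < \<epsilon>" "\<forall>a\<in>parcs G. 0 \<le> f a + \<epsilon> * g a"
      "\<forall>a\<in>parcs G. 0 \<le> (u a - f a) + \<epsilon> * (- g a)" "\<forall>i\<in>pverts G. 0 \<le> \<kappa> i + \<epsilon> * k i"
      "\<forall>i\<in>pverts G. 0 \<le> (e i + \<kappa> i) + \<epsilon> * (net g i + k i)"
    by auto
  define f' \<kappa>' where "f' = (\<lambda>a. f a + \<epsilon> * g a)" and "\<kappa>' = (\<lambda>i. \<kappa> i + \<epsilon> * k i)"
  have "excess G \<gamma> b f' i = e i + \<epsilon> * net g i" for i
    by (simp add: f'_def excess_eq net_add net_scale)
  then have feas': "feasible G u \<gamma> b f' \<kappa>'"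
    using \<epsilon> by (auto simp: feasible_def pseudoflow_def f'_def \<kappa>'_def algebra_simps)
  have inf0: "\<kappa> i = 0" if "i \<in> pverts G" "M i = \<infinity>" for i
    using discrepancy_finite[OF fin _ that] feas by (auto simp: feasible_def)
  have "(\<Sum>i\<in>pverts G. real_of_ereal (M i) * \<kappa>' i) =
      (\<Sum>i\<in>pverts G. real_of_ereal (M i) * \<kappa> i) + \<epsilon> * (\<Sum>i\<in>pverts G. real_of_ereal (M i) * k i)"
    by (simp add: \<kappa>'_def sum_distrib_left sum.distrib algebra_simps)
  also have "\<dots> < (\<Sum>i\<in>pverts G. real_of_ereal (M i) * \<kappa> i)"
    using neg \<epsilon>(1) by (simp add: mult_pos_neg)
  finally have "discrepancy G M \<kappa>' < discrepancy G M \<kappa>"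
    using inf0 kinf by (simp add: discrepancy_real \<kappa>'_def)
  with feas' show thesis by (rule that)
qed

subsection \<open>Pushing flow along residual walks\<close>

text \<open>The flow change that takes one unit out of the tail of a residual arc. For a backward
  arc the tail is the head of \<open>a\<close>, which loses one unit when the flow on
  \<open>a\<close> drops by \<open>1 / \<gamma> a\<close>.\<close>

fun unit_push :: "'v residual_arc \<Rightarrow> 'v \<times> 'v \<Rightarrow> real" where
  "unit_push (Forward a) x = of_bool (x = a)"
| "unit_push (Backward a) x = - of_bool (x = a) / \<gamma> a"

text \<open>One unit leaves the start; what arrives at the head of \<open>r\<close> is
  \<open>res_gain \<gamma> r\<close>, and this amount is sent along the rest of the walk.\<close>

fun push :: "'v residual_arc list \<Rightarrow> 'v \<times> 'v \<Rightarrow> real" where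
  "push [] = (\<lambda>x. 0)"
| "push (r # p) = (\<lambda>x. unit_push r x + res_gain \<gamma> r * push p x)"

lemma net_unit_push:
  assumes "r \<in> arcs (residual G u f)"
  shows "net (unit_push r) i = res_gain \<gamma> r * of_bool (res_head r = i) - of_bool (res_tail r = i)"
proof -
  have "(\<Sum>x\<in>parcs G. of_bool (x = a) * h x) = h a" if "a \<in> parcs G" for a and h :: "'v \<times> 'v \<Rightarrow> real"
    using that pair_finite_arcs by simp
  note single = this
  from assms obtain a where a: "a \<in> parcs G" "r = Forward a \<or> r = Backward a"
    by (auto simp: arcs_residual)
  from a(2) show ?thesis
  proof
    assume "r = Forward a"
    then show ?thesis
      using single[OF a(1)] by (simp add: net_def)
  next
    assume r: "r = Backward a"
    have "net (unit_push r) i = (\<Sum>x\<in>parcs G. of_bool (x = a) *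
        (- 1 / \<gamma> a * (\<gamma> x * of_bool (snd x = i) - of_bool (fst x = i))))"
      unfolding net_def r by (rule sum.cong) auto
    then show ?thesis
      unfolding single[OF a(1)] using gain_pos[OF a(1)] r by (simp add: field_simps)
  qed
qed

text \<open>Contributions at inner nodes cancel. For a closed walk both indicators meet in one node,
  where the net amount \<open>walk_gain \<gamma> p - 1\<close> remains.\<close>

lemma net_push:
  "res.awalk s p t \<Longrightarrow> net (push p) i = walk_gain \<gamma> p * of_bool (i = t) - of_bool (i = s)"
proof (induction p arbitrary: s)
  case Nil
  then show ?case by (simp add: net_def res.awalk_Nil_iff)
next
  case (Cons r p)
  have r: "r \<in> arcs (residual G u f)" "res_tail r = s" "res.awalk (res_head r) p t"
    using Cons.prems by (auto simp: res.awalk_Cons_iff)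
  have "net (push (r # p)) i = net (unit_push r) i + res_gain \<gamma> r * net (push p) i"
    by (simp add: net_add net_scale)
  also have "\<dots> = walk_gain \<gamma> (r # p) * of_bool (i = t) - of_bool (i = s)"
    unfolding net_unit_push[OF r(1)] Cons.IH[OF r(3)] r(2) by (auto simp: algebra_simps)
  finally show ?case .
qed

text \<open>Unit pushes enter with positive coefficients, so a net increase on an arc needs its
  forward copy in the walk and a net decrease its backward copy.\<close>

lemma admissible_push: "set p \<subseteq> arcs (residual G u f) \<Longrightarrow> admissible (push p)"
proof (induction p)
  case Nil
  then show ?case by (simp add: admissible_def)
next
  case (Cons r p)
  obtain a where "a \<in> parcs G" "r = Forward a \<and> f a < u a \<or> r = Backward a \<and> 0 < f a"
    using Cons.prems by (auto simp: arcs_residual)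
  then have "admissible (unit_push r)"
    using gain_pos[of a] by (auto simp: admissible_def of_bool_def split: if_splits)
  moreover have "admissible (\<lambda>x. res_gain \<gamma> r * push p x)"
    using Cons by (intro admissible_scale) (auto simp: res_gain_pos)
  ultimately show ?case
    using admissible_add by simp
qed

lemma apathD:
  assumes "res.apath s P t"
  shows "res.awalk s P t" "set P \<subseteq> arcs (residual G u f)" "s \<in> pverts G" "t \<in> pverts G"
    "0 < walk_gain \<gamma> P"
proof -
  show walk: "res.awalk s P t"
    using assms by (rule res.awalkI_apath)
  then show arcs: "set P \<subseteq> arcs (residual G u f)"
    by auto
  show "s \<in> pverts G" "t \<in> pverts G"
    using res.awalk_hd_in_verts[OF walk] res.awalk_last_in_verts[OF walk] by simp_all
  show "0 < walk_gain \<gamma> P"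
    using arcs by (rule walk_gain_pos)
qed

text \<open>Makes a flow generating cycle start at the node where the path to the deficit branches
  off; a product of gains is invariant under rotation.\<close>

lemma cycle_rotate:
  assumes "res.cycle C" "i \<in> res_tail ` set C"
  obtains C' where "res.awalk i C' i" "walk_gain \<gamma> C' = walk_gain \<gamma> C"
proof -
  obtain v where v: "res.awalk v C v"
    using assms(1) by (auto simp: res.cycle_def)
  obtain r where "r \<in> set C" and i: "i = res_tail r"
    using assms(2) by auto
  then obtain p q where C: "C = p @ r # q"
    by (auto dest: split_list)
  have "res.awalk v p i" "res.awalk i (r # q) v"
    using v i by (auto simp: C res.awalk_Cons_iff)
  then have "res.awalk i ((r # q) @ p) i"
    by (rule res.awalk_appendI[rotated])
  then show thesis
    by (rule that) (simp add: C)
qed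

text \<open>Every type of augmenting path gives a descent direction. Types (a) and (b) only lower
  \<open>\<kappa> t\<close>; type (c) trades a larger \<open>\<kappa> s\<close> for a smaller
  \<open>\<kappa> t\<close>.\<close>

lemma no_gap_if_optimal:
  assumes "optimal G u \<gamma> b M f"
  shows "\<not> gap G u \<gamma> b M f C P"
proof
  assume gap: "gap G u \<gamma> b M f C P"
  from assms obtain \<kappa> where feas: "feasible G u \<gamma> b f \<kappa>" and fin: "discrepancy G M \<kappa> < \<infinity>"
    and best: "\<And>f' \<kappa>'. feasible G u \<gamma> b f' \<kappa>' \<Longrightarrow> discrepancy G M \<kappa> \<le> discrepancy G M \<kappa>'"
    by (auto simp: optimal_def)
  \<comment> \<open>A deficit forces \<open>\<kappa> t\<close> to be positive, which a finite
    objective permits only at a finite penalty.\<close>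
  have deficit: "0 < \<kappa> t \<and> (\<exists>m. M t = ereal m \<and> 0 < m)" if "t \<in> pverts G" "e t < 0" for t
  proof -
    have "0 \<le> \<kappa> i" if "i \<in> pverts G" for i
      using feas that by (simp add: feasible_def)
    moreover have "0 \<le> e t + \<kappa> t"
      using feas that by (simp add: feasible_def)
    ultimately show ?thesis
      using discrepancy_finite[OF fin _ that(1)] that penalty_pos[OF that(1)]
      by (cases "M t") auto
  qed
  \<comment> \<open>Common to types (a) and (b): the inflow \<open>w\<close> at \<open>t\<close>
    pays for lowering \<open>\<kappa> t\<close>. Nodes of positive excess may lose flow, because
    their constraint \<open>0 \<le> e i + \<kappa> i\<close> is slack.\<close>
  have False if g: "admissible g" and t: "t \<in> pverts G" "e t < 0" and w: "0 < w"
    and net: "\<And>i. i \<in> pverts G \<Longrightarrow> e i \<le> 0 \<Longrightarrow> w * of_bool (i = t) \<le> net g i" for g t w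
  proof -
    obtain m where m: "M t = ereal m" "0 < m" "0 < \<kappa> t"
      using deficit t by blast
    define k where "k i = - w * of_bool (i = t)" for i
    have "(\<Sum>i\<in>pverts G. real_of_ereal (M i) * k i) = (\<Sum>i\<in>pverts G. if i = t then - w * m else 0)"
      by (rule sum.cong) (auto simp: k_def m)
    then have neg: "(\<Sum>i\<in>pverts G. real_of_ereal (M i) * k i) < 0"
      using t pair_finite_verts w m by simp
    show False
    proof (rule feasible_descent[OF feas fin g _ _ _ neg])
      fix i assume i: "i \<in> pverts G"
      show "0 \<le> k i" if "\<kappa> i = 0"
        using that m by (auto simp: k_def)
      show "0 \<le> net g i + k i" if "e i + \<kappa> i = 0"
      proof -
        have "0 \<le> \<kappa> i"
          using feas i by (simp add: feasible_def)
        then show ?thesis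
          using net[OF i] that by (simp add: k_def)
      qed
      show "k i = 0" if "M i = \<infinity>"
        using that m by (auto simp: k_def)
    qed (use best in force)
  qed
  note ascent = this
  from gap consider
    (cyc) i\<^sub>0 t where "res.cycle C" "1 < walk_gain \<gamma> C" "i\<^sub>0 \<in> res_tail ` set C"
      "res.apath i\<^sub>0 P t" "e t < 0"
  | (pos) s t where "res.apath s P t" "0 < e s" "e t < 0"
  | (penalty) s t where "res.apath s P t" "e s \<le> 0" "e t < 0" "M s / M t < ereal (walk_gain \<gamma> P)"
    unfolding gap_def by blast
  then show False
  proof cases
    case cyc
    obtain C' where C': "res.awalk i\<^sub>0 C' i\<^sub>0" "walk_gain \<gamma> C' = walk_gain \<gamma> C"
      using cyc by (blast intro: cycle_rotate)
    \<comment> \<open>A unit sent around the cycle returns with the surplus \<open>c\<close>.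
      Sending exactly \<open>c\<close> along \<open>P\<close> leaves net inflow zero everywhere
      except for \<open>c * walk_gain \<gamma> P\<close> at \<open>t\<close>, even if
      \<open>i\<^sub>0 = t\<close>.\<close>
    define c where "c = walk_gain \<gamma> C - 1"
    define g where "g = (\<lambda>x. push C' x + c * push P x)"
    have "0 < c"
      using cyc by (simp add: c_def)
    show False
    proof (rule ascent)
      show "admissible g"
        unfolding g_def using \<open>0 < c\<close> C' apathD(2)[OF cyc(4)]
        by (intro admissible_add admissible_scale admissible_push) auto
      show "0 < c * walk_gain \<gamma> P"
        using \<open>0 < c\<close> apathD[OF cyc(4)] by simp
      show "(c * walk_gain \<gamma> P) * of_bool (i = t) \<le> net g i" for i
        unfolding g_def net_add net_scale net_push[OF C'(1)] net_push[OF apathD(1)[OF cyc(4)]] C'(2)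
        by (simp add: c_def algebra_simps)
    qed (use apathD[OF cyc(4)] cyc in auto)
  next
    case pos
    show False
    proof (rule ascent)
      show "admissible (push P)"
        using apathD[OF pos(1)] by (intro admissible_push)
      show "walk_gain \<gamma> P * of_bool (i = t) \<le> net (push P) i" if "e i \<le> 0" for i
        using that pos unfolding net_push[OF apathD(1)[OF pos(1)]] by auto
    qed (use apathD[OF pos(1)] pos in auto)
  next
    case penalty
    note P = apathD[OF penalty(1)]
    obtain m where m: "M t = ereal m" "0 < m" "0 < \<kappa> t"
      using deficit P(4) penalty by blast
    have "M s \<noteq> \<infinity>"
      using penalty(4) m by (auto simp: divide_ereal_def)
    then obtain n where n: "M s = ereal n" "0 < n"
      using penalty_pos[OF P(3)] by (cases "M s") auto
    have gain: "n < m * walk_gain \<gamma> P"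
      using penalty(4) m n by (simp add: field_simps)
    \<comment> \<open>The unit taken from \<open>s\<close> is covered by raising
      \<open>\<kappa> s\<close>, and the amount arriving at \<open>t\<close> lowers
      \<open>\<kappa> t\<close>; \<open>net (push P) + k\<close> vanishes, and the cost changes by
      \<open>n - m * walk_gain \<gamma> P\<close>.\<close>
    define k where "k i = of_bool (i = s) - walk_gain \<gamma> P * of_bool (i = t)" for i
    have "s \<noteq> t"
    proof
      assume "s = t"
      then have "P = []"
        using res.apath_nonempty_ends[OF penalty(1)] by blast
      then show False
        using gain m n \<open>s = t\<close> by simp
    qed
    have "(\<Sum>i\<in>pverts G. real_of_ereal (M i) * k i) =
        (\<Sum>i\<in>pverts G. (if i = s then n else 0) - (if i = t then m * walk_gain \<gamma> P else 0))"
      by (rule sum.cong) (use \<open>s \<noteq> t\<close> in \<open>auto simp: k_def m n\<close>)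
    then have neg: "(\<Sum>i\<in>pverts G. real_of_ereal (M i) * k i) < 0"
      using pair_finite_verts P gain by (simp add: sum_subtractf)
    show False
    proof (rule feasible_descent[OF feas fin admissible_push[OF P(2)] _ _ _ neg])
      fix i
      show "0 \<le> k i" if "\<kappa> i = 0"
        using that m by (auto simp: k_def)
      show "0 \<le> net (push P) i + k i"
        by (simp add: net_push[OF P(1)] k_def)
      show "k i = 0" if "M i = \<infinity>"
        using that m n by (auto simp: k_def)
    qed (use best in force)
  qed
qed

subsection \<open>Labels from best paths\<close>

text \<open>The penalty that a unit sent from \<open>i\<close> can save at a deficit node.
  Restricting to simple paths keeps the set finite, so the best value is attained.\<close>

definition path_values :: "'v \<Rightarrow> real set" where
  "path_values i = {real_of_ereal (M t) * walk_gain \<gamma> p | p t. res.apath i p t \<and> e t < 0}"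

lemma finite_path_values: "finite (path_values i)"
proof -
  have "path_values i \<subseteq> (\<Union>t\<in>pverts G. (\<lambda>p. real_of_ereal (M t) * walk_gain \<gamma> p) ` {p. res.apath i p t})"
    unfolding path_values_def using apathD(4) by fastforce
  then show ?thesis
    by (rule finite_subset) (use pair_finite_verts res.apaths_finite in auto)
qed

text \<open>The conjunct on all finite labels covers the nodes with
  \<open>\<mu> i = 1 / M i\<close>, where the theorem asks for a nonpositive excess.\<close>

lemma conservative_labeling_if_no_gap:
  assumes no_gap: "\<And>C P. \<not> gap G u \<gamma> b M f C P"
  shows "\<exists>\<mu>. conservative G u \<gamma> b M f \<mu> \<and> (\<forall>i\<in>pverts G. \<mu> i < \<infinity> \<longrightarrow> e i \<le> 0) \<and>
    (\<forall>i\<in>pverts G. 1 / M i < \<mu> i \<and> \<mu> i < \<infinity> \<longrightarrow> e i = 0)"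
proof -
  have deficit: "\<exists>m. M t = ereal m \<and> 0 < m" if t: "t \<in> pverts G" "e t < 0" for t
  proof (cases "M t")
    case PInf
    \<comment> \<open>The empty path from \<open>t\<close> to itself is augmenting since \<open>\<infinity> / \<infinity> = 0\<close>.\<close>
    have "res.apath t [] t"
      using t by (simp add: res.apath_Nil_iff)
    then have "gap G u \<gamma> b M f [] []"
      using t PInf unfolding gap_def by (auto intro!: exI[of _ t])
    then show ?thesis using no_gap by blast
  qed (use penalty_pos[OF t(1)] in auto)
  \<comment> \<open>Without type (b) no surplus node reaches a deficit; then the absence of type (c)
    bounds the value of the path by the penalty of its start.\<close>
  have source: "e s \<le> 0" "ereal (real_of_ereal (M t) * walk_gain \<gamma> P) \<le> M s"
    if P: "res.apath s P t" and t: "e t < 0" for s P t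
  proof -
    note D = apathD[OF P]
    show "e s \<le> 0"
      using no_gap[of "[]" P] P t unfolding gap_def by (meson not_le)
    then have le: "ereal (walk_gain \<gamma> P) \<le> M s / M t"
      using no_gap[of "[]" P] P t unfolding gap_def by (meson not_le)
    obtain m where "M t = ereal m" "0 < m"
      using deficit D(4) t by blast
    then show "ereal (real_of_ereal (M t) * walk_gain \<gamma> P) \<le> M s"
      using le penalty_pos[OF D(3)] by (cases "M s") (auto simp: field_simps)
  qed
  have pos: "0 < x" if x: "x \<in> path_values i" for x i
  proof -
    from x obtain p t where p: "x = real_of_ereal (M t) * walk_gain \<gamma> p" "res.apath i p t" "e t < 0"
      by (auto simp: path_values_def)
    obtain m where "M t = ereal m" "0 < m"
      using deficit p apathD(4) by blast
    then show ?thesis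
      using p apathD(5) by simp
  qed
  \<comment> \<open>The Bellman inequality for best path values. If prefixing \<open>r\<close> does
    not give a simple path, then \<open>r\<close> closes a cycle with an initial part
    \<open>q\<close> of \<open>p\<close>. By the absence of type (a) its gain is at most 1, so the
    remaining path \<open>q'\<close> is at least as good.\<close>
  have extend: "\<exists>y\<in>path_values (res_tail r). res_gain \<gamma> r * x \<le> y"
    if r: "r \<in> arcs (residual G u f)" and x: "x \<in> path_values (res_head r)" for r x
  proof -
    from x obtain p t where p: "x = real_of_ereal (M t) * walk_gain \<gamma> p"
        "res.apath (res_head r) p t" "e t < 0"
      by (auto simp: path_values_def)
    show ?thesis
    proof (cases "res_tail r \<in> set (res.awalk_verts (res_head r) p)")
      case False
      then have "res.apath (res_tail r) (r # p) t"
        using r p by (simp add: res.apath_Cons_iff)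
      then have "real_of_ereal (M t) * walk_gain \<gamma> (r # p) \<in> path_values (res_tail r)"
        unfolding path_values_def using p by blast
      then show ?thesis
        by (rule bexI[rotated]) (simp add: p(1) mult.left_commute)
    next
      case True
      then obtain q q' where q: "p = q @ q'" "res.awalk (res_head r) q (res_tail r)"
          "res.awalk (res_tail r) q' t"
        using res.awalk_decomp[OF apathD(1)[OF p(2)]] by blast
      then have paths: "res.apath (res_head r) q (res_tail r)" "res.apath (res_tail r) q' t"
        using p(2) by (auto simp: res.apath_append_iff)
      have "res.cycle (r # q)"
        unfolding res.cycle_def using paths r
        by (intro exI[of _ "res_tail r"]) (auto simp: res.apath_def res.awalk_Cons_iff)
      moreover have "res_tail r \<in> res_tail ` set (r # q)"
        by simp
      ultimately have "walk_gain \<gamma> (r # q) \<le> 1"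
        using no_gap[of "r # q" q'] paths p(3) unfolding gap_def by (meson not_le)
      moreover have "real_of_ereal (M t) * walk_gain \<gamma> q' \<in> path_values (res_tail r)"
        using paths p by (auto simp: path_values_def)
      moreover from this have "0 < real_of_ereal (M t) * walk_gain \<gamma> q'"
        by (rule pos)
      ultimately show ?thesis
        using mult_right_mono[of "walk_gain \<gamma> (r # q)" 1 "real_of_ereal (M t) * walk_gain \<gamma> q'"]
        by (intro bexI) (auto simp: p(1) q(1) algebra_simps)
    qed
  qed
  define \<mu> where "\<mu> i = (if path_values i = {} then \<infinity> else ereal (1 / Max (path_values i)))" for i
  have Max_pos: "0 < Max (path_values i)" if "path_values i \<noteq> {}" for i
    by (rule pos[OF Max_in[OF finite_path_values that]])
  have Max_le: "ereal (Max (path_values i)) \<le> M i" and nonpos: "e i \<le> 0"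
    if "path_values i \<noteq> {}" for i
  proof -
    have "Max (path_values i) \<in> path_values i"
      using that finite_path_values by (rule Max_in[rotated])
    then show "ereal (Max (path_values i)) \<le> M i" "e i \<le> 0"
      using source by (auto simp: path_values_def)
  qed
  have eq: "\<mu> i = 1 / M i" if i: "i \<in> pverts G" "e i < 0" for i
  proof -
    obtain m where m: "M i = ereal m" "0 < m"
      using deficit i by blast
    \<comment> \<open>The empty path shows that the best value at a deficit node is at least its
      penalty; \<open>Max_le\<close> gives the converse.\<close>
    have "res.apath i [] i"
      using i by (simp add: res.apath_Nil_iff)
    then have mem: "m \<in> path_values i"
      unfolding path_values_def using m i
      by (intro CollectI exI[of _ "[]"] exI[of _ i]) simp
    have "Max (path_values i) \<le> m"
      using Max_le[of i] mem m by auto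
    moreover have "m \<le> Max (path_values i)"
      using mem finite_path_values by simp
    ultimately show ?thesis
      using mem m by (auto simp: \<mu>_def one_ereal_def)
  qed
  have "conservative G u \<gamma> b M f \<mu>"
    unfolding conservative_def labeling_def
  proof (intro conjI ballI impI)
    fix i assume i: "i \<in> pverts G"
    show "0 < \<mu> i"
      using Max_pos by (auto simp: \<mu>_def)
    show "1 / M i \<le> \<mu> i"
    proof (cases "path_values i = {}")
      case False
      then show ?thesis
        using Max_le[OF False] Max_pos[OF False] penalty_pos[OF i]
        by (cases "M i") (simp_all add: \<mu>_def one_ereal_def field_simps)
    qed (simp add: \<mu>_def)
  next
    fix r assume r: "r \<in> arcs (residual G u f)"
    show "relabeled_gain \<gamma> \<mu> r \<le> 1"
    proof (cases "path_values (res_head r) = {}")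
      \<comment> \<open>Division by an infinite head label yields 0, even if the tail label is
        infinite as well.\<close>
      case True
      then show ?thesis
        by (simp add: relabeled_gain_def \<mu>_def)
    next
      case False
      then have "Max (path_values (res_head r)) \<in> path_values (res_head r)"
        using finite_path_values by (rule Max_in[rotated])
      then obtain y where y: "y \<in> path_values (res_tail r)"
          "res_gain \<gamma> r * Max (path_values (res_head r)) \<le> y"
        using extend r by blast
      then have "res_gain \<gamma> r * Max (path_values (res_head r)) \<le> Max (path_values (res_tail r))"
        using finite_path_values Max_ge order_trans by blast
      moreover have "path_values (res_tail r) \<noteq> {}"
        using y by auto
      ultimately show ?thesis
        using False Max_pos[of "res_head r"] Max_pos[of "res_tail r"]
        by (simp add: relabeled_gain_def \<mu>_def one_ereal_def field_simps)
    qed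
  qed (fact eq)
  moreover have "e i \<le> 0" if "\<mu> i < \<infinity>" for i
    using that nonpos by (auto simp: \<mu>_def split: if_splits)
  moreover have "e i = 0" if "i \<in> pverts G" "1 / M i < \<mu> i" "\<mu> i < \<infinity>" for i
    using that nonpos[of i] eq[of i] by (cases "e i < 0") (auto simp: \<mu>_def split: if_splits)
  ultimately show ?thesis
    by blast
qed

subsection \<open>Complementary slackness\<close>

text \<open>Weak duality: \<open>\<pi> = 1 / \<mu>\<close> is dual feasible, so the sum of
  \<open>- \<pi> i * e i\<close> bounds the value of every solution from below, and slackness makes
  \<open>f\<close> attain it.\<close>

lemma optimal_if_conservative:
  fixes \<mu> :: "'v \<Rightarrow> ereal"
  assumes cons: "conservative G u \<gamma> b M f \<mu>"
    and pos_inf: "\<And>i. i \<in> pverts G \<Longrightarrow> 0 < e i \<Longrightarrow> \<mu> i = \<infinity>"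
  shows "optimal G u \<gamma> b M f"
proof -
  have \<mu>_pos: "0 < \<mu> i" if "i \<in> pverts G" for i
    using cons that by (simp add: conservative_def labeling_def)
  \<comment> \<open>Infinite labels become \<open>\<pi> i = 0\<close>, so surplus nodes contribute
    nothing.\<close>
  define \<pi> where "\<pi> i = real_of_ereal (1 / \<mu> i)" for i
  have \<pi>_nonneg: "0 \<le> \<pi> i" if "i \<in> pverts G" for i
    using \<mu>_pos[OF that] by (cases "\<mu> i") (auto simp: \<pi>_def one_ereal_def)
  have \<pi>_le: "\<pi> i \<le> real_of_ereal (M i)" if "i \<in> pverts G" "M i \<noteq> \<infinity>" for i
  proof -
    have "1 / M i \<le> \<mu> i"
      using cons that by (simp add: conservative_def)
    then show ?thesis
      using \<mu>_pos[OF that(1)] penalty_pos[OF that(1)] that(2)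
      by (cases "\<mu> i"; cases "M i") (auto simp: \<pi>_def one_ereal_def field_simps)
  qed
  \<comment> \<open>With \<open>M i = \<infinity>\<close> the label \<open>1 / M i\<close> would be
    0, against positivity.\<close>
  have deficit: "M i \<noteq> \<infinity> \<and> \<pi> i = real_of_ereal (M i)" if "i \<in> pverts G" "e i < 0" for i
  proof -
    have "\<mu> i = 1 / M i"
      using cons that by (simp add: conservative_def)
    then show ?thesis
      using \<mu>_pos[OF that(1)] penalty_pos[OF that(1)]
      by (cases "M i") (auto simp: \<pi>_def one_ereal_def)
  qed
  \<comment> \<open>An infinite tail label with a finite head label would make the relabeled gain
    infinite; if the head label is infinite, the left side is 0.\<close>
  have \<pi>_arc: "res_gain \<gamma> r * \<pi> (res_head r) \<le> \<pi> (res_tail r)" if r: "r \<in> arcs (residual G u f)" for r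
  proof -
    have "relabeled_gain \<gamma> \<mu> r \<le> 1"
      using cons r by (simp add: conservative_def)
    then show ?thesis
      using \<mu>_pos[of "res_tail r"] \<mu>_pos[of "res_head r"] res_gain_pos[OF r] r
        res.tail_in_verts[OF r] res.head_in_verts[OF r]
      by (cases "\<mu> (res_tail r)"; cases "\<mu> (res_head r)")
        (auto simp: relabeled_gain_def \<pi>_def one_ereal_def field_simps)
  qed
  define \<kappa> where "\<kappa> i = max 0 (- e i)" for i
  have inf0: "\<kappa> i = 0" if "i \<in> pverts G" "M i = \<infinity>" for i
    using deficit[of i] that by (fastforce simp: \<kappa>_def max_def)
  have feas: "feasible G u \<gamma> b f \<kappa>"
    using pseudoflow by (auto simp: feasible_def \<kappa>_def max_def)
  have disc: "discrepancy G M \<kappa> = ereal (\<Sum>i\<in>pverts G. real_of_ereal (M i) * \<kappa> i)"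
    using inf0 by (rule discrepancy_real)
  have "discrepancy G M \<kappa> \<le> discrepancy G M \<kappa>'" if feas': "feasible G u \<gamma> b f' \<kappa>'" for f' \<kappa>'
  proof (cases "discrepancy G M \<kappa>' < \<infinity>")
    case True
    have nonneg: "0 \<le> \<kappa>' i" "0 \<le> excess G \<gamma> b f' i + \<kappa>' i" if "i \<in> pverts G" for i
      using feas' that by (auto simp: feasible_def)
    have inf0': "\<kappa>' i = 0" if "i \<in> pverts G" "M i = \<infinity>" for i
      using discrepancy_finite[OF True nonneg(1) that] .
    define g where "g a = f' a - f a" for a
    have "f' = (\<lambda>a. f a + g a)"
      by (simp add: g_def)
    then have exc: "excess G \<gamma> b f' i = e i + net g i" for i
      by (simp add: excess_eq net_add)
    \<comment> \<open>Wherever \<open>f'\<close> exceeds \<open>f\<close> the forward arc is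
      residual, and wherever it is smaller the backward arc is; \<open>\<pi>_arc\<close> therefore
      fixes the sign of every summand.\<close>
    have "(\<Sum>i\<in>pverts G. \<pi> i * net g i) \<le> 0"
      unfolding sum_mult_net
    proof (rule sum_nonpos)
      fix a assume a: "a \<in> parcs G"
      have bounds: "0 \<le> f' a" "f' a \<le> u a"
        using feas' a by (auto simp: feasible_def pseudoflow_def)
      consider "f a < f' a" | "f' a < f a" | "f' a = f a"
        by linarith
      then show "g a * (\<gamma> a * \<pi> (snd a) - \<pi> (fst a)) \<le> 0"
      proof cases
        case 1
        then have "Forward a \<in> arcs (residual G u f)"
          using a bounds by (auto simp: arcs_residual)
        then show ?thesis
          using \<pi>_arc[of "Forward a"] 1 by (simp add: g_def mult_nonneg_nonpos)
      next
        case 2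
        then have "Backward a \<in> arcs (residual G u f)"
          using a bounds by (auto simp: arcs_residual)
        then have "\<pi> (fst a) \<le> \<gamma> a * \<pi> (snd a)"
          using \<pi>_arc[of "Backward a"] gain_pos[OF a] by (simp add: field_simps)
        then show ?thesis
          using 2 by (simp add: g_def mult_nonpos_nonneg)
      qed (simp add: g_def)
    qed
    then have "(\<Sum>i\<in>pverts G. - \<pi> i * e i) \<le> (\<Sum>i\<in>pverts G. - \<pi> i * excess G \<gamma> b f' i)"
      by (simp add: exc distrib_left sum.distrib sum_negf sum_subtractf)
    also have "\<dots> \<le> (\<Sum>i\<in>pverts G. real_of_ereal (M i) * \<kappa>' i)"
    proof (rule sum_mono)
      fix i assume i: "i \<in> pverts G"
      have "- \<pi> i * excess G \<gamma> b f' i \<le> \<pi> i * \<kappa>' i"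
        using mult_left_mono[of "- excess G \<gamma> b f' i" "\<kappa>' i" "\<pi> i"] \<pi>_nonneg[OF i] nonneg[OF i] by simp
      also have "\<dots> \<le> real_of_ereal (M i) * \<kappa>' i"
        using \<pi>_le[OF i] inf0'[OF i] nonneg[OF i] by (cases "M i = \<infinity>") (auto intro: mult_right_mono)
      finally show "- \<pi> i * excess G \<gamma> b f' i \<le> real_of_ereal (M i) * \<kappa>' i" .
    qed
    \<comment> \<open>Termwise slackness: at a deficit \<open>\<pi> i\<close> equals the penalty and
      \<open>\<kappa> i = - e i\<close>; at a surplus both \<open>\<pi> i\<close> and
      \<open>\<kappa> i\<close> are 0.\<close>
    also have "(\<Sum>i\<in>pverts G. - \<pi> i * e i) = (\<Sum>i\<in>pverts G. real_of_ereal (M i) * \<kappa> i)"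
    proof (rule sum.cong[OF refl])
      fix i assume i: "i \<in> pverts G"
      consider "e i < 0" | "e i = 0" | "0 < e i"
        by linarith
      then show "- \<pi> i * e i = real_of_ereal (M i) * \<kappa> i"
        by cases (use deficit[OF i] pos_inf[OF i] in \<open>auto simp: \<kappa>_def \<pi>_def\<close>)
    qed
    finally show ?thesis
      using disc discrepancy_real[OF inf0'] by simp
  qed simp
  then show ?thesis
    unfolding optimal_def using feas disc by (intro exI[of _ \<kappa>]) auto
qed

end

(* The last conjunct of the labeling condition excludes a positive excess at a node with
   \<mu> i = 1 / M i. Without it the labeling condition does not imply optimality: take a single arc
   st with unit capacity, gain and penalties, zero flow, excess 1 at s and -1 at t, and \<mu> = 1. *)
theorem theorem2:
  fixes G :: "'v pair_pre_digraph"
    and u \<gamma> f :: "'v \<times> 'v \<Rightarrow> real"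
    and b :: "'v \<Rightarrow> real"
    and M :: "'v \<Rightarrow> ereal"
  assumes "pair_fin_digraph G"
    and "\<forall>a\<in>parcs G. 0 \<le> u a"
    and "\<forall>a\<in>parcs G. 0 < \<gamma> a"
    and "\<forall>i\<in>pverts G. 0 < M i"
    and "pseudoflow G u f"
  shows "(optimal G u \<gamma> b M f \<longleftrightarrow> \<not> (\<exists>C P. gap G u \<gamma> b M f C P)) \<and>
    (\<not> (\<exists>C P. gap G u \<gamma> b M f C P) \<longleftrightarrow>
      (\<exists>\<mu>. conservative G u \<gamma> b M f \<mu> \<and>
        (\<forall>i\<in>pverts G. 1 / M i < \<mu> i \<and> \<mu> i < \<infinity> \<longrightarrow> excess G \<gamma> b f i = 0) \<and>
        (\<forall>i\<in>pverts G. \<mu> i = 1 / M i \<longrightarrow> excess G \<gamma> b f i \<le> 0)))"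
    (is "(?optimal \<longleftrightarrow> ?no_gap) \<and> (_ \<longleftrightarrow> ?labeling)")
proof -
  interpret pair_fin_digraph G
    by fact
  interpret generalized_flow G u \<gamma> f b M
    by unfold_locales (use assms in auto)
  have "?no_gap" if "?optimal"
    using no_gap_if_optimal[OF that] by blast
  moreover have "?labeling" if no_gap: "?no_gap"
  proof -
    obtain \<mu> where "conservative G u \<gamma> b M f \<mu>"
        "\<forall>i\<in>pverts G. \<mu> i < \<infinity> \<longrightarrow> e i \<le> 0"
        "\<forall>i\<in>pverts G. 1 / M i < \<mu> i \<and> \<mu> i < \<infinity> \<longrightarrow> e i = 0"
      using conservative_labeling_if_no_gap no_gap by blast
    moreover have "1 / M i < \<infinity>" if "i \<in> pverts G" for i
      using penalty_pos[OF that] by (cases "M i") (auto simp: one_ereal_def)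
    ultimately show ?thesis
      by (intro exI[of _ \<mu>]) auto
  qed
  moreover have "?optimal" if "?labeling"
  proof -
    from that obtain \<mu> where \<mu>: "conservative G u \<gamma> b M f \<mu>"
        "\<forall>i\<in>pverts G. 1 / M i < \<mu> i \<and> \<mu> i < \<infinity> \<longrightarrow> e i = 0"
        "\<forall>i\<in>pverts G. \<mu> i = 1 / M i \<longrightarrow> e i \<le> 0"
      by blast
    \<comment> \<open>A positive excess rules out the label \<open>1 / M i\<close> as well as every
      larger finite one, and conservativeness excludes smaller labels.\<close>
    have "\<mu> i = \<infinity>" if i: "i \<in> pverts G" "0 < e i" for i
    proof (rule ccontr)
      assume "\<mu> i \<noteq> \<infinity>"
      moreover have "1 / M i \<le> \<mu> i"
        using \<mu>(1) i by (simp add: conservative_def)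
      ultimately show False
        using \<mu>(2,3) i by (cases "\<mu> i = 1 / M i") (force simp: order_less_le)+
    qed
    with \<mu>(1) show ?thesis
      by (rule optimal_if_conservative)
  qed
  ultimately show ?thesis
    by blast
qed

end
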